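(* Let $k_1,k_2,k_3\in\mathbb{Z}_{\ge0}$ and let $(X,Y,Z)$ be a $(k_1,k_2,k_3)$-CMM triple associated with the non-labeled cluster $(a,b,c)$, and assume $|b|>\max\{|a|,|c|\}$. Then there exist a unique $f\in\mathbb{Z}[x_1^{\pm1},x_2^{\pm1},x_3^{\pm1}]$, a unique $\sigma\in\mathfrak{S}_3$ and a unique vertex $v$ of $\mathrm{CMM}\mathbb{T}(k_1,k_2,k_3,\sigma,f)$ such that $v=(X,Y,Z)$.
   Context: Fix $k_1,k_2,k_3\in\mathbb{Z}_{\ge0}$, indeterminates $x_1,x_2,x_3$; $\mathbb{Z}[x^\pm]=\mathbb{Z}[x_1^{\pm1},x_2^{\pm1},x_3^{\pm1}]$. Mutations: $\mu_1(a,b,c)=(\frac{b^2+k_1bc+c^2}{a},b,c)$, $\mu_2(a,b,c)=(a,\frac{a^2+k_2ac+c^2}{b},c)$, $\mu_3(a,b,c)=(a,b,\frac{a^2+k_3ab+b^2}{c})$. Labeled clusters of $\mathcal{A}(k_1,k_2,k_3)$: triples obtained from $(x_1,x_2,x_3)$ by finitely many mutations; non-labeled clusters: permutations of labeled clusters; cluster variables: entries of labeled clusters. A cluster variable $y$ occurs in a unique position $i$ among labeled clusters; its parity is $k_y:=k_i$. $|a|$ denotes the value of a Laurent polynomial $a$ at $x_1=x_2=x_3=1$. $\mathscr{M}=\frac{x_1^2+x_2^2+x_3^2+k_1x_2x_3+k_2x_1x_3+k_3x_1x_2}{x_1x_2x_3}$, $T=\begin{bmatrix}-1&0\\ \mathscr{M}&-1\end{bmatrix}$.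 A CMM matrix is $X\in SL(2,\mathbb{Z}[x^\pm])$ with $(1,2)$-entry $x_{12}$ a cluster variable and $\mathrm{tr}X=-k_{x_{12}}$; a CMM triple is a triple $(X,Y,Z)$ of CMM matrices with $XYZ=T$ and $(x_{12},y_{12},z_{12})$ a non-labeled cluster (the triple is associated with it). For $\sigma\in\mathfrak{S}_3$, $f\in\mathbb{Z}[x^\pm]$, write $y_i=x_{\sigma(i)}$, $\kappa_i=k_{\sigma(i)}$ and define (with $(2,1)$-entries $*$ determined by determinant $1$): $X_\sigma(f)=\begin{bmatrix}f&y_1\\ *&-f-\kappa_1\end{bmatrix}$, $Y_\sigma(f)=\begin{bmatrix}\frac{fy_2-\kappa_2y_1-y_3}{y_1}&y_2\\ *&\frac{-fy_2+y_3}{y_1}\end{bmatrix}$, $Z_\sigma(f)=\begin{bmatrix}\frac{fy_2y_3-\kappa_3y_1y_2-\kappa_2y_1y_3-y_1^2-y_3^2}{y_1y_2}&y_3\\ *&\frac{-fy_2y_3+\kappa_2y_1y_3+y_1^2+y_3^2}{y_1y_2}\end{bmatrix}$. The tree $\mathrm{CMM}\mathbb{T}(k_1,k_2,k_3,\sigma,f)$ is the rooted planar binary tree whose root is $(X_\tau(f),\,Y_\tau(f)Z_\tau(f)Y_\tau(f)^{-1},\,Y_\tau(f))$ with $\tau=\sigma\circ(2\ 3)$ (composition right to left), and in which each vertex $(X,Y,Z)$ has left child $(X,YZY^{-1},Y)$ and right child $(Y,Y^{-1}XY,Z)$. *)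

theory Defs
  imports
    "HOL-Analysis.Determinants"
    "HOL-Library.Numeral_Type"
    "HOL-Library.Poly_Mapping"
    "HOL-Computational_Algebra.Polynomial_Factorial"
begin

text \<open>
  Integral Laurent polynomials in three indeterminates are finitely supported maps from exponent
  vectors in \<open>\<int>\<^sup>3\<close> to \<open>\<int>\<close>. The indices are the elements \<open>1\<close>, \<open>2\<close> and \<open>3\<close> of the numeral type
  \<open>3\<close>, in which arithmetic is modulo 3 (so \<open>3\<close> is a third index and equals \<open>0\<close>).
\<close>

type_synonym laurent = "(3 \<Rightarrow>\<^sub>0 int) \<Rightarrow>\<^sub>0 int"

definition var :: "3 \<Rightarrow> laurent" where
  "var i = Poly_Mapping.single (Poly_Mapping.single i 1) 1"

definition var_inv :: "3 \<Rightarrow> laurent" where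
  "var_inv i = Poly_Mapping.single (Poly_Mapping.single i (-1)) 1"

definition laurent_eval :: "(3 \<Rightarrow> 'a :: field) \<Rightarrow> laurent \<Rightarrow> 'a" where
  "laurent_eval t p =
     (\<Sum>e\<in>Poly_Mapping.keys p.
        of_int (Poly_Mapping.lookup p e) * (\<Prod>i\<in>UNIV. t i powi Poly_Mapping.lookup e i))"

definition val_one :: "laurent \<Rightarrow> rat" where
  "val_one p = laurent_eval (\<lambda>_. 1) p"


text \<open>
  A labeled cluster is a triple of elements of the field of rational functions, written as a
  function of its position. As arithmetic on indices is modulo 3, the two positions other than
  \<open>i\<close> are \<open>i + 1\<close> and \<open>i + 2\<close>.
\<close>

definition mutation :: "(3 \<Rightarrow> nat) \<Rightarrow> 3 \<Rightarrow> (3 \<Rightarrow> laurent fract) \<Rightarrow> (3 \<Rightarrow> laurent fract)" where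
  "mutation k i C =
     C(i := ((C (i + 1))\<^sup>2 + of_nat (k i) * C (i + 1) * C (i + 2) + (C (i + 2))\<^sup>2) / C i)"

inductive_set labeled_clusters :: "(3 \<Rightarrow> nat) \<Rightarrow> (3 \<Rightarrow> laurent fract) set" for k where
  initial: "(\<lambda>i. to_fract (var i)) \<in> labeled_clusters k"
| mutate: "C \<in> labeled_clusters k \<Longrightarrow> mutation k i C \<in> labeled_clusters k"

definition nonlabeled_clusters ::
    "(3 \<Rightarrow> nat) \<Rightarrow> (laurent fract \<times> laurent fract \<times> laurent fract) set" where
  "nonlabeled_clusters k =
     {(C (p 1), C (p 2), C (p 3)) | C p. C \<in> labeled_clusters k \<and> p permutes UNIV}"

definition cluster_variables :: "(3 \<Rightarrow> nat) \<Rightarrow> laurent fract set" where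
  "cluster_variables k = {C i | C i. C \<in> labeled_clusters k}"

text \<open>
  A cluster variable occurs in only one position of the labeled clusters. The value is
  meaningful for cluster variables only.
\<close>

definition parity :: "(3 \<Rightarrow> nat) \<Rightarrow> laurent fract \<Rightarrow> nat" where
  "parity k y = k (THE i. \<exists>C\<in>labeled_clusters k. C i = y)"


type_synonym mat2 = "laurent^2^2"

definition mat22 :: "laurent \<Rightarrow> laurent \<Rightarrow> laurent \<Rightarrow> laurent \<Rightarrow> mat2" where
  "mat22 a b c d = vector [vector [a, b], vector [c, d]]"

definition markov :: "(3 \<Rightarrow> nat) \<Rightarrow> laurent" where
  "markov k =
     ((var 1)\<^sup>2 + (var 2)\<^sup>2 + (var 3)\<^sup>2
       + of_nat (k 1) * var 2 * var 3 + of_nat (k 2) * var 1 * var 3 + of_nat (k 3) * var 1 * var 2)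
     * (var_inv 1 * var_inv 2 * var_inv 3)"

definition T_mat :: "(3 \<Rightarrow> nat) \<Rightarrow> mat2" where
  "T_mat k = mat22 (-1) 0 (markov k) (-1)"

definition cmm_matrix :: "(3 \<Rightarrow> nat) \<Rightarrow> mat2 \<Rightarrow> bool" where
  "cmm_matrix k X \<longleftrightarrow>
     det X = 1 \<and> to_fract (X $ 1 $ 2) \<in> cluster_variables k \<and>
     trace X = - of_nat (parity k (to_fract (X $ 1 $ 2)))"

definition cmm_triple :: "(3 \<Rightarrow> nat) \<Rightarrow> mat2 \<times> mat2 \<times> mat2 \<Rightarrow> bool" where
  "cmm_triple k = (\<lambda>(X, Y, Z).
     cmm_matrix k X \<and> cmm_matrix k Y \<and> cmm_matrix k Z \<and> X ** Y ** Z = T_mat k \<and>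
     (to_fract (X $ 1 $ 2), to_fract (Y $ 1 $ 2), to_fract (Z $ 1 $ 2)) \<in> nonlabeled_clusters k)"

definition cmm_associated ::
    "(3 \<Rightarrow> nat) \<Rightarrow> mat2 \<times> mat2 \<times> mat2 \<Rightarrow> laurent \<times> laurent \<times> laurent \<Rightarrow> bool" where
  "cmm_associated k = (\<lambda>(X, Y, Z) (a, b, c).
     cmm_triple k (X, Y, Z) \<and> X $ 1 $ 2 = a \<and> Y $ 1 $ 2 = b \<and> Z $ 1 $ 2 = c)"


text \<open>
  The matrix with first row \<open>(a, x\<^sub>i)\<close> and lower right entry \<open>d\<close> whose remaining entry is
  \<open>(a d - 1) / x\<^sub>i\<close>, the only value that gives determinant 1.
\<close>

definition sl2_with :: "laurent \<Rightarrow> 3 \<Rightarrow> laurent \<Rightarrow> mat2" where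
  "sl2_with a i d = mat22 a (var i) ((a * d - 1) * var_inv i) d"

definition X_init :: "(3 \<Rightarrow> nat) \<Rightarrow> (3 \<Rightarrow> 3) \<Rightarrow> laurent \<Rightarrow> mat2" where
  "X_init k \<sigma> f = sl2_with f (\<sigma> 1) (- f - of_nat (k (\<sigma> 1)))"

definition Y_init :: "(3 \<Rightarrow> nat) \<Rightarrow> (3 \<Rightarrow> 3) \<Rightarrow> laurent \<Rightarrow> mat2" where
  "Y_init k \<sigma> f =
     (let y1 = var (\<sigma> 1); y2 = var (\<sigma> 2); y3 = var (\<sigma> 3); y1_inv = var_inv (\<sigma> 1);
          \<kappa>2 = of_nat (k (\<sigma> 2))
      in sl2_with ((f * y2 - \<kappa>2 * y1 - y3) * y1_inv) (\<sigma> 2) ((- (f * y2) + y3) * y1_inv))"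

definition Z_init :: "(3 \<Rightarrow> nat) \<Rightarrow> (3 \<Rightarrow> 3) \<Rightarrow> laurent \<Rightarrow> mat2" where
  "Z_init k \<sigma> f =
     (let y1 = var (\<sigma> 1); y2 = var (\<sigma> 2); y3 = var (\<sigma> 3);
          y12_inv = var_inv (\<sigma> 1) * var_inv (\<sigma> 2);
          \<kappa>2 = of_nat (k (\<sigma> 2)); \<kappa>3 = of_nat (k (\<sigma> 3))
      in sl2_with
           ((f * y2 * y3 - \<kappa>3 * y1 * y2 - \<kappa>2 * y1 * y3 - y1\<^sup>2 - y3\<^sup>2) * y12_inv)
           (\<sigma> 3)
           ((- (f * y2 * y3) + \<kappa>2 * y1 * y3 + y1\<^sup>2 + y3\<^sup>2) * y12_inv))"


datatype direction = Left | Right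

fun cmm_child :: "direction \<Rightarrow> mat2 \<times> mat2 \<times> mat2 \<Rightarrow> mat2 \<times> mat2 \<times> mat2" where
  "cmm_child Left (X, Y, Z) = (X, Y ** Z ** matrix_inv Y, Y)"
| "cmm_child Right (X, Y, Z) = (Y, matrix_inv Y ** X ** Y, Z)"

definition cmm_root :: "(3 \<Rightarrow> nat) \<Rightarrow> (3 \<Rightarrow> 3) \<Rightarrow> laurent \<Rightarrow> mat2 \<times> mat2 \<times> mat2" where
  "cmm_root k \<sigma> f =
     (let \<tau> = \<sigma> \<circ> Transposition.transpose 2 3;
          X = X_init k \<tau> f; Y = Y_init k \<tau> f; Z = Z_init k \<tau> f
      in (X, Y ** Z ** matrix_inv Y, Y))"

text \<open>
  The vertices of the infinite binary tree are the finite words of directions, read from the root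
  downwards. \<open>cmm_tree k \<sigma> f v\<close> is the matrix triple at the vertex \<open>v\<close>.
\<close>

definition cmm_tree ::
    "(3 \<Rightarrow> nat) \<Rightarrow> (3 \<Rightarrow> 3) \<Rightarrow> laurent \<Rightarrow> direction list \<Rightarrow> mat2 \<times> mat2 \<times> mat2" where
  "cmm_tree k \<sigma> f v = fold cmm_child v (cmm_root k \<sigma> f)"

end

theory Submission
  imports Defs
begin

text \<open>
  In a triple of matrices of determinant 1 and product \<open>T\<close>, conjugation mutates the
  \<open>(1,2)\<close>-entries.
  Along a reduced sequence of mutations the last mutated variable is the strict maximum of the
  values at \<open>(1,1,1)\<close>. So if the middle entry is the maximum, undoing the last mutation by a
  conjugation moves the triple to its parent, and the descent ends at a triple over a neighbour
  of the initial cluster, which is determined by its upper left entry. Conversely the values of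
  the outer entries of a vertex tell whether it is the root (equal values), a left child (the
  third is greater) or a right child (the first is greater), and this gives uniqueness.

  That a cluster variable occurs in one position only (so that its parity is well defined) is
  seen by setting \<open>x\<^sub>i = s\<close> and the other variables to 1: a cluster variable then grows like a
  power of \<open>s\<close>, and the exponent is odd exactly for the variables in position \<open>i\<close>.
\<close>

section \<open>Evaluation\<close>

lemma laurent_eval_superset:
  assumes "finite A" "Poly_Mapping.keys p \<subseteq> A"
  shows "laurent_eval t p =
    (\<Sum>e\<in>A. of_int (Poly_Mapping.lookup p e) * (\<Prod>i\<in>UNIV. t i powi Poly_Mapping.lookup e i))"
  unfolding laurent_eval_def
  by (rule sum.mono_neutral_left) (use assms in \<open>auto simp: in_keys_iff\<close>)

lemma laurent_eval_zero: "laurent_eval t 0 = 0"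
  by (simp add: laurent_eval_def)

lemma laurent_eval_single:
  "laurent_eval t (Poly_Mapping.single e c) =
     of_int c * (\<Prod>i\<in>UNIV. t i powi Poly_Mapping.lookup e i)"
  by (subst laurent_eval_superset[of "{e}"]) auto

lemma laurent_eval_add: "laurent_eval t (p + q) = laurent_eval t p + laurent_eval t q"
proof -
  let ?A = "Poly_Mapping.keys p \<union> Poly_Mapping.keys q"
  have "Poly_Mapping.keys (p + q) \<subseteq> ?A" by (rule keys_add)
  then show ?thesis
    by (simp add: laurent_eval_superset[of ?A] lookup_add sum.distrib distrib_right)
qed

lemma laurent_eval_one: "laurent_eval t 1 = 1"
  using laurent_eval_single[of t 0 1] by (simp add: Poly_Mapping.single_one)

lemma laurent_eval_of_nat: "laurent_eval t (of_nat n) = of_nat n"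
  by (induction n) (simp_all add: laurent_eval_zero laurent_eval_one laurent_eval_add)

text \<open>Updating a key outside the support amounts to adding a monomial, so an additive property
  reduces to its monomial case.\<close>

lemma poly_mapping_induct_add [case_names zero add]:
  assumes "P 0" "\<And>f e c. P f \<Longrightarrow> P (f + Poly_Mapping.single e c)"
  shows "P (p :: 'a \<Rightarrow>\<^sub>0 'b :: comm_monoid_add)"
proof (induction p rule: Poly_Mapping.update_induct)
  case (update f e c)
  have "Poly_Mapping.update e c f = f + Poly_Mapping.single e c"
    using update(1)
    by (intro poly_mapping_eqI)
      (auto simp: lookup_update lookup_add lookup_single in_keys_iff when_def)
  then show ?case using assms(2) update(3) by simp
qed (rule assms(1))

text \<open>Additivity in each factor reduces the claim to two monomials, whose exponents add. As
  exponents may be negative, \<open>t i powi (m + n)\<close> splits into a product because no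
  \<open>t i\<close> is 0.\<close>

lemma laurent_eval_mult:
  assumes "\<And>i. t i \<noteq> 0"
  shows "laurent_eval t (p * q) = laurent_eval t p * laurent_eval t q"
proof (induction p rule: poly_mapping_induct_add)
  case (add p e c)
  have "laurent_eval t (Poly_Mapping.single e c * q) =
    laurent_eval t (Poly_Mapping.single e c) * laurent_eval t q"
  proof (induction q rule: poly_mapping_induct_add)
    case (add q e' c')
    then show ?case
      using assms
      by (simp add: mult_single laurent_eval_single lookup_add power_int_add prod.distrib
          laurent_eval_add distrib_left)
  qed (simp add: laurent_eval_zero)
  with add show ?case by (simp add: laurent_eval_add distrib_right)
qed (simp add: laurent_eval_zero)

lemma laurent_eval_var: "laurent_eval t (var i) = t i"
proof -
  have "(\<Prod>j\<in>UNIV. t j powi Poly_Mapping.lookup (Poly_Mapping.single i 1) j) =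
    (\<Prod>j\<in>UNIV. if j = i then t j else 1)"
    by (rule prod.cong) (auto simp: lookup_single when_def)
  then show ?thesis by (simp add: var_def laurent_eval_single)
qed

lemma var_mult_var_inv: "var i * var_inv i = 1"
  by (simp add: var_def var_inv_def mult_single flip: single_add)

section \<open>Values of rational functions\<close>

text \<open>Evaluation is only partial on the fraction field, since a denominator may vanish at
  \<open>t\<close>; hence a relation. The fraction need not be in lowest terms.\<close>

definition fract_val :: "(3 \<Rightarrow> rat) \<Rightarrow> laurent fract \<Rightarrow> rat \<Rightarrow> bool" where
  "fract_val t x r \<longleftrightarrow>
     (\<exists>p q. laurent_eval t q \<noteq> 0 \<and> x = to_fract p / to_fract q \<and>
            r = laurent_eval t p / laurent_eval t q)"

lemma fract_val_to_fract: "fract_val t (to_fract p) (laurent_eval t p)"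
  unfolding fract_val_def by (rule exI[of _ p], rule exI[of _ 1]) (simp add: laurent_eval_one)

lemma fract_val_of_nat: "fract_val t (of_nat n) (of_nat n)"
proof -
  have "to_fract (of_nat n :: laurent) = of_nat n" by (induction n) auto
  then show ?thesis using fract_val_to_fract[of t "of_nat n"] by (simp add: laurent_eval_of_nat)
qed

context
  fixes t :: "3 \<Rightarrow> rat"
  assumes t: "\<And>i. t i \<noteq> 0"
begin

text \<open>Cross multiplication turns two representations of \<open>x\<close> into one identity of
  Laurent polynomials, to which multiplicativity of evaluation applies.\<close>

lemma fract_val_unique:
  assumes "fract_val t x r" "fract_val t x s"
  shows "r = s"
proof -
  obtain p q where p: "laurent_eval t q \<noteq> 0" "x = to_fract p / to_fract q"
    "r = laurent_eval t p / laurent_eval t q"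
    using assms(1) by (auto simp: fract_val_def)
  obtain p' q' where p': "laurent_eval t q' \<noteq> 0" "x = to_fract p' / to_fract q'"
    "s = laurent_eval t p' / laurent_eval t q'"
    using assms(2) by (auto simp: fract_val_def)
  have "q \<noteq> 0" "q' \<noteq> 0" using p p' by (auto simp: laurent_eval_zero)
  then have "to_fract (p * q') = to_fract (p' * q)"
    using p(2) p'(2) by (simp add: field_simps)
  then have "p * q' = p' * q" by (simp only: to_fract_eq_iff)
  then have "laurent_eval t p * laurent_eval t q' = laurent_eval t p' * laurent_eval t q"
    using t by (metis laurent_eval_mult)
  then show ?thesis using p(1) p'(1) by (simp add: p(3) p'(3) frac_eq_eq)
qed

lemma fract_val_add:
  assumes "fract_val t x r" "fract_val t y s"
  shows "fract_val t (x + y) (r + s)"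
proof -
  obtain p q where p: "laurent_eval t q \<noteq> 0" "x = to_fract p / to_fract q"
    "r = laurent_eval t p / laurent_eval t q"
    using assms(1) by (auto simp: fract_val_def)
  obtain p' q' where p': "laurent_eval t q' \<noteq> 0" "y = to_fract p' / to_fract q'"
    "s = laurent_eval t p' / laurent_eval t q'"
    using assms(2) by (auto simp: fract_val_def)
  have "q \<noteq> 0" "q' \<noteq> 0" using p p' by (auto simp: laurent_eval_zero)
  then show ?thesis unfolding fract_val_def
    by (intro exI[of _ "p * q' + p' * q"] exI[of _ "q * q'"])
      (use p p' t in \<open>simp add: laurent_eval_mult laurent_eval_add add_frac_eq\<close>)
qed

lemma fract_val_mult:
  assumes "fract_val t x r" "fract_val t y s"
  shows "fract_val t (x * y) (r * s)"
proof -
  obtain p q where p: "laurent_eval t q \<noteq> 0" "x = to_fract p / to_fract q"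
    "r = laurent_eval t p / laurent_eval t q"
    using assms(1) by (auto simp: fract_val_def)
  obtain p' q' where p': "laurent_eval t q' \<noteq> 0" "y = to_fract p' / to_fract q'"
    "s = laurent_eval t p' / laurent_eval t q'"
    using assms(2) by (auto simp: fract_val_def)
  show ?thesis unfolding fract_val_def
    by (intro exI[of _ "p * p'"] exI[of _ "q * q'"])
      (use p p' t in \<open>simp add: laurent_eval_mult\<close>)
qed

lemma fract_val_divide:
  assumes "fract_val t x r" "fract_val t y s" "s \<noteq> 0"
  shows "fract_val t (x / y) (r / s)"
proof -
  obtain p q where p: "laurent_eval t q \<noteq> 0" "x = to_fract p / to_fract q"
    "r = laurent_eval t p / laurent_eval t q"
    using assms(1) by (auto simp: fract_val_def)
  obtain p' q' where p': "laurent_eval t q' \<noteq> 0" "y = to_fract p' / to_fract q'"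
    "s = laurent_eval t p' / laurent_eval t q'"
    using assms(2) by (auto simp: fract_val_def)
  show ?thesis unfolding fract_val_def
    by (intro exI[of _ "p * q'"] exI[of _ "q * p'"])
      (use p p' t assms(3) in \<open>simp add: laurent_eval_mult\<close>)
qed

end

lemma shift_exhaust: "j = i \<or> j = i + 1 \<or> j = i + (2::3)"
  using exhaust_3[of i] exhaust_3[of j] by auto

section \<open>Positions of cluster variables\<close>

text \<open>On the curve where coordinate \<open>i\<close> is \<open>s\<close> and the others are 1,
  \<open>x\<close> grows like \<open>s powi n\<close>. The lower bound is positive, so sums cannot
  cancel and the exponents obey max-plus arithmetic.\<close>

definition asymp_exp :: "3 \<Rightarrow> laurent fract \<Rightarrow> int \<Rightarrow> bool" where
  "asymp_exp i x n \<longleftrightarrow>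
     (\<exists>A>0. \<exists>B>0. \<forall>s\<ge>1. \<exists>r. fract_val (\<lambda>j. if j = i then s else 1) x r \<and>
        A * s powi n \<le> r \<and> r \<le> B * s powi n)"

lemma asymp_expE:
  assumes "asymp_exp i x n"
  obtains A B f where "A > 0" "B > 0"
    "\<And>s. s \<ge> 1 \<Longrightarrow> fract_val (\<lambda>j. if j = i then s else 1) x (f s)"
    "\<And>s. s \<ge> 1 \<Longrightarrow> A * s powi n \<le> f s" "\<And>s. s \<ge> 1 \<Longrightarrow> f s \<le> B * s powi n"
    "\<And>s. s \<ge> 1 \<Longrightarrow> f s > 0"
proof -
  obtain A B where AB: "A > 0" "B > 0" and "\<forall>s\<ge>1. \<exists>r. fract_val (\<lambda>j. if j = i then s else 1) x r \<and>
        A * s powi n \<le> r \<and> r \<le> B * s powi n"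
    using assms unfolding asymp_exp_def by blast
  then obtain f where f: "\<And>s. s \<ge> 1 \<Longrightarrow> fract_val (\<lambda>j. if j = i then s else 1) x (f s) \<and>
        A * s powi n \<le> f s \<and> f s \<le> B * s powi n"
    by metis
  have "f s > 0" if "s \<ge> 1" for s
  proof -
    have "0 < A * s powi n" using AB that by simp
    also have "\<dots> \<le> f s" using f that by blast
    finally show ?thesis .
  qed
  with f AB that show thesis by blast
qed

lemma asymp_expI:
  assumes "A > 0" "B > 0"
    "\<And>s. s \<ge> 1 \<Longrightarrow> fract_val (\<lambda>j. if j = i then s else 1) x (f s)"
    "\<And>s. s \<ge> 1 \<Longrightarrow> A * s powi n \<le> f s" "\<And>s. s \<ge> 1 \<Longrightarrow> f s \<le> B * s powi n"
  shows "asymp_exp i x n"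
  unfolding asymp_exp_def using assms by blast

lemma asymp_exp_var: "asymp_exp i (to_fract (var j)) (if j = i then 1 else 0)"
proof (rule asymp_expI[of 1 1 i _ "\<lambda>s. if j = i then s else 1"])
  fix s :: rat
  show "fract_val (\<lambda>j. if j = i then s else 1) (to_fract (var j)) (if j = i then s else 1)"
    using fract_val_to_fract[of "\<lambda>j. if j = i then s else 1" "var j"]
    by (simp only: laurent_eval_var)
qed simp_all

lemma asymp_exp_of_nat:
  assumes "n > 0"
  shows "asymp_exp i (of_nat n) 0"
  using assms fract_val_of_nat
  by (intro asymp_expI[of "of_nat n" "of_nat n" i _ "\<lambda>_. of_nat n"]) simp_all

lemma asymp_exp_mult:
  assumes "asymp_exp i x n" "asymp_exp i y m"
  shows "asymp_exp i (x * y) (n + m)"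
proof -
  obtain A B f where f: "A > 0" "B > 0"
    "\<And>s. s \<ge> 1 \<Longrightarrow> fract_val (\<lambda>j. if j = i then s else 1) x (f s)"
    "\<And>s. s \<ge> 1 \<Longrightarrow> A * s powi n \<le> f s" "\<And>s. s \<ge> 1 \<Longrightarrow> f s \<le> B * s powi n"
    "\<And>s. s \<ge> 1 \<Longrightarrow> f s > 0"
    using asymp_expE[OF assms(1)] by blast
  obtain C D g where g: "C > 0" "D > 0"
    "\<And>s. s \<ge> 1 \<Longrightarrow> fract_val (\<lambda>j. if j = i then s else 1) y (g s)"
    "\<And>s. s \<ge> 1 \<Longrightarrow> C * s powi m \<le> g s" "\<And>s. s \<ge> 1 \<Longrightarrow> g s \<le> D * s powi m"
    "\<And>s. s \<ge> 1 \<Longrightarrow> g s > 0"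
    using asymp_expE[OF assms(2)] by blast
  show ?thesis
  proof (rule asymp_expI[of "A * C" "B * D" i _ "\<lambda>s. f s * g s"])
    fix s :: rat assume s: "s \<ge> 1"
    show "fract_val (\<lambda>j. if j = i then s else 1) (x * y) (f s * g s)"
      using f g s by (intro fract_val_mult) auto
    have "(A * s powi n) * (C * s powi m) \<le> f s * g s"
      using f g s by (intro mult_mono) (auto intro: less_imp_le)
    then show "A * C * s powi (n + m) \<le> f s * g s"
      using s by (simp add: power_int_add mult_ac)
    have "f s * g s \<le> (B * s powi n) * (D * s powi m)"
      using f g s by (intro mult_mono) (auto intro: less_imp_le)
    then show "f s * g s \<le> B * D * s powi (n + m)"
      using s by (simp add: power_int_add mult_ac)
  qed (use f g in auto)
qed

lemma asymp_exp_divide: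
  assumes "asymp_exp i x n" "asymp_exp i y m"
  shows "asymp_exp i (x / y) (n - m)"
proof -
  obtain A B f where f: "A > 0" "B > 0"
    "\<And>s. s \<ge> 1 \<Longrightarrow> fract_val (\<lambda>j. if j = i then s else 1) x (f s)"
    "\<And>s. s \<ge> 1 \<Longrightarrow> A * s powi n \<le> f s" "\<And>s. s \<ge> 1 \<Longrightarrow> f s \<le> B * s powi n"
    "\<And>s. s \<ge> 1 \<Longrightarrow> f s > 0"
    using asymp_expE[OF assms(1)] by blast
  obtain C D g where g: "C > 0" "D > 0"
    "\<And>s. s \<ge> 1 \<Longrightarrow> fract_val (\<lambda>j. if j = i then s else 1) y (g s)"
    "\<And>s. s \<ge> 1 \<Longrightarrow> C * s powi m \<le> g s" "\<And>s. s \<ge> 1 \<Longrightarrow> g s \<le> D * s powi m"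
    "\<And>s. s \<ge> 1 \<Longrightarrow> g s > 0"
    using asymp_expE[OF assms(2)] by blast
  show ?thesis
  proof (rule asymp_expI[of "A / D" "B / C" i _ "\<lambda>s. f s / g s"])
    fix s :: rat assume s: "s \<ge> 1"
    have "g s \<noteq> 0" using g(6)[OF s] by simp
    then show "fract_val (\<lambda>j. if j = i then s else 1) (x / y) (f s / g s)"
      using f(3) g(3) s by (intro fract_val_divide) auto
    have "(A * s powi n) / (D * s powi m) \<le> f s / g s"
      using f g s by (intro frac_le) (auto intro: less_imp_le)
    then show "A / D * s powi (n - m) \<le> f s / g s"
      using s by (simp add: power_int_diff)
    have "f s / g s \<le> (B * s powi n) / (C * s powi m)"
      using f g s by (intro frac_le) (auto intro: less_imp_le)
    then show "f s / g s \<le> B / C * s powi (n - m)"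
      using s by (simp add: power_int_diff)
  qed (use f g in auto)
qed

lemma asymp_exp_add:
  assumes "asymp_exp i x n" "asymp_exp i y m"
  shows "asymp_exp i (x + y) (max n m)"
proof -
  obtain A B f where f: "A > 0" "B > 0"
    "\<And>s. s \<ge> 1 \<Longrightarrow> fract_val (\<lambda>j. if j = i then s else 1) x (f s)"
    "\<And>s. s \<ge> 1 \<Longrightarrow> A * s powi n \<le> f s" "\<And>s. s \<ge> 1 \<Longrightarrow> f s \<le> B * s powi n"
    "\<And>s. s \<ge> 1 \<Longrightarrow> f s > 0"
    using asymp_expE[OF assms(1)] by blast
  obtain C D g where g: "C > 0" "D > 0"
    "\<And>s. s \<ge> 1 \<Longrightarrow> fract_val (\<lambda>j. if j = i then s else 1) y (g s)"
    "\<And>s. s \<ge> 1 \<Longrightarrow> C * s powi m \<le> g s" "\<And>s. s \<ge> 1 \<Longrightarrow> g s \<le> D * s powi m"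
    "\<And>s. s \<ge> 1 \<Longrightarrow> g s > 0"
    using asymp_expE[OF assms(2)] by blast
  show ?thesis
  proof (rule asymp_expI[of "min A C" "B + D" i _ "\<lambda>s. f s + g s"])
    fix s :: rat assume s: "s \<ge> 1"
    show "fract_val (\<lambda>j. if j = i then s else 1) (x + y) (f s + g s)"
      using f(3) g(3) s by (intro fract_val_add) auto
    have "min A C * s powi n \<le> A * s powi n" "min A C * s powi m \<le> C * s powi m"
      using s by (auto intro!: mult_right_mono)
    then have "min A C * s powi n \<le> f s" "min A C * s powi m \<le> g s"
      using f(4)[OF s] g(4)[OF s] by linarith+
    \<comment> \<open>The summand with the larger exponent gives the bound; the other one is
      positive and is dropped.\<close>
    then show "min A C * s powi (max n m) \<le> f s + g s"
      using f(6)[OF s] g(6)[OF s] by (cases "n \<le> m") (auto simp: max_def)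
    have "s powi n \<le> s powi max n m" "s powi m \<le> s powi max n m"
      using s by (auto intro!: power_int_increasing)
    then have "B * s powi n \<le> B * s powi max n m" "D * s powi m \<le> D * s powi max n m"
      using f g by auto
    then show "f s + g s \<le> (B + D) * s powi max n m"
      using f(5)[OF s] g(5)[OF s] by (simp add: distrib_right)
  qed (use f g in auto)
qed

lemma asymp_exp_le:
  assumes "asymp_exp i x n" "asymp_exp i x m"
  shows "n \<le> m"
proof (rule ccontr)
  assume "\<not> n \<le> m"
  obtain A B f where f: "A > 0" "B > 0"
    "\<And>s. s \<ge> 1 \<Longrightarrow> fract_val (\<lambda>j. if j = i then s else 1) x (f s)"
    "\<And>s. s \<ge> 1 \<Longrightarrow> A * s powi n \<le> f s" "\<And>s. s \<ge> 1 \<Longrightarrow> f s \<le> B * s powi n"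
    "\<And>s. s \<ge> 1 \<Longrightarrow> f s > 0"
    using asymp_expE[OF assms(1)] by blast
  obtain C D g where g: "C > 0" "D > 0"
    "\<And>s. s \<ge> 1 \<Longrightarrow> fract_val (\<lambda>j. if j = i then s else 1) x (g s)"
    "\<And>s. s \<ge> 1 \<Longrightarrow> C * s powi m \<le> g s" "\<And>s. s \<ge> 1 \<Longrightarrow> g s \<le> D * s powi m"
    "\<And>s. s \<ge> 1 \<Longrightarrow> g s > 0"
    using asymp_expE[OF assms(2)] by blast
  \<comment> \<open>For n > m the two bounds force \<open>A * s \<le> D\<close> for every
    \<open>s \<ge> 1\<close>; this choice has \<open>A * s = D + A\<close>.\<close>
  define s where "s = D / A + 1"
  have s: "s \<ge> 1" using f g by (simp add: s_def)
  have "f s = g s"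
    using f(3)[OF s] g(3)[OF s] s by (intro fract_val_unique[of _ x]) auto
  then have "A * s powi n \<le> D * s powi m" using f(4)[OF s] g(5)[OF s] by simp
  moreover have "s powi (m + 1) \<le> s powi n"
    using s \<open>\<not> n \<le> m\<close> by (intro power_int_increasing) auto
  ultimately have "A * s powi (m + 1) \<le> D * s powi m"
    using f(1) by (meson less_imp_le mult_left_mono order_trans)
  then have "A * s \<le> D" using s by (simp add: power_int_add)
  moreover have "A * s = D + A" using f(1) by (simp add: s_def field_simps)
  ultimately show False using f(1) by simp
qed

lemma asymp_exp_nonzero:
  assumes "asymp_exp i x n"
  shows "x \<noteq> 0"
proof
  assume "x = 0"
  obtain A B f where f: "A > 0" "B > 0"
    "\<And>s. s \<ge> 1 \<Longrightarrow> fract_val (\<lambda>j. if j = i then s else 1) x (f s)"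
    "\<And>s. s \<ge> 1 \<Longrightarrow> A * s powi n \<le> f s" "\<And>s. s \<ge> 1 \<Longrightarrow> f s \<le> B * s powi n"
    "\<And>s. s \<ge> 1 \<Longrightarrow> f s > 0"
    using asymp_expE[OF assms] by blast
  have "fract_val (\<lambda>_. 1) x (f 1)" using f(3)[of 1] by simp
  moreover have "fract_val (\<lambda>_. 1) x 0"
    using fract_val_of_nat[of _ 0] \<open>x = 0\<close> by simp
  ultimately have "f 1 = 0" by (intro fract_val_unique[of "\<lambda>_. 1" x]) simp_all
  with f(6)[of 1] show False by simp
qed

text \<open>This is mutation in max-plus arithmetic. The mixed term of the numerator has the sum of
  the two neighbouring exponents, which never exceeds twice their maximum.\<close>

lemma asymp_exp_mutation:
  assumes "\<And>j. asymp_exp i (C j) (n j)"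
  shows "asymp_exp i (mutation k l C j)
    (if j = l then 2 * max (n (l + 1)) (n (l + 2)) - n l else n j)"
proof -
  let ?b = "C (l + 1)" and ?c = "C (l + 2)" and ?m = "max (n (l + 1)) (n (l + 2))"
  have bc: "asymp_exp i (?b\<^sup>2 + ?c\<^sup>2) (2 * ?m)"
    using asymp_exp_add[OF asymp_exp_mult[OF assms[of "l + 1"] assms[of "l + 1"]]
        asymp_exp_mult[OF assms[of "l + 2"] assms[of "l + 2"]]]
    by (simp add: power2_eq_square max_def split: if_splits)
  have "asymp_exp i (?b\<^sup>2 + of_nat (k l) * ?b * ?c + ?c\<^sup>2) (2 * ?m)"
  \<comment> \<open>For \<open>k l = 0\<close> the mixed term is zero and has no exponent at
    all.\<close>
  proof (cases "k l = 0")
    case False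
    then have "asymp_exp i (of_nat (k l)) 0" by (intro asymp_exp_of_nat) simp
    from asymp_exp_mult[OF asymp_exp_mult[OF this assms[of "l + 1"]] assms[of "l + 2"]]
    have "asymp_exp i (of_nat (k l) * ?b * ?c) (n (l + 1) + n (l + 2))" by simp
    from asymp_exp_add[OF bc this] show ?thesis
      by (simp add: add_ac max_def split: if_splits)
  qed (use bc in simp)
  from asymp_exp_divide[OF this assms[of l]] show ?thesis
    using assms by (simp add: mutation_def)
qed

text \<open>
  Mutation replaces an exponent \<open>n\<close> by \<open>2 max - n\<close>, so the exponents modulo 2 depend only on
  the position in the cluster.
\<close>

lemma labeled_cluster_asymp_exp:
  assumes "C \<in> labeled_clusters k"
  shows "\<exists>n. \<forall>j. asymp_exp i (C j) (n j) \<and> (odd (n j) \<longleftrightarrow> j = i)"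
  using assms
proof (induction)
  case initial
  show ?case
    by (rule exI[of _ "\<lambda>j. if j = i then 1 else 0"]) (use asymp_exp_var in auto)
next
  case (mutate C l)
  then obtain n where n: "\<And>j. asymp_exp i (C j) (n j)" "\<And>j. odd (n j) \<longleftrightarrow> j = i" by blast
  show ?case
    by (rule exI[of _ "\<lambda>j. if j = l then 2 * max (n (l + 1)) (n (l + 2)) - n l else n j"])
      (use asymp_exp_mutation[of i C n k l] n in auto)
qed

lemma labeled_cluster_nonzero:
  assumes "C \<in> labeled_clusters k"
  shows "C i \<noteq> 0"
  using labeled_cluster_asymp_exp[OF assms, of i] asymp_exp_nonzero by blast

text \<open>Growth is tested in direction \<open>i\<close>. The exponent of the common variable is
  unique, and it is odd by its position in \<open>C\<close>; in \<open>D\<close> only position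
  \<open>i\<close> has an odd exponent.\<close>

lemma cluster_variable_position_unique:
  assumes "C \<in> labeled_clusters k" "D \<in> labeled_clusters k" "C i = D j"
  shows "i = j"
proof -
  obtain n where n: "asymp_exp i (C i) (n i)" "odd (n i)"
    using labeled_cluster_asymp_exp[OF assms(1), of i] by blast
  obtain m where m: "asymp_exp i (D j) (m j)" "odd (m j) \<longleftrightarrow> j = i"
    using labeled_cluster_asymp_exp[OF assms(2), of i] by blast
  have "n i = m j"
    using asymp_exp_le n(1) m(1) assms(3) by (metis order_antisym)
  with n m show ?thesis by simp
qed

lemma parity_cluster:
  assumes "C \<in> labeled_clusters k"
  shows "parity k (C i) = k i"
proof -
  have "(THE j. \<exists>D\<in>labeled_clusters k. D j = C i) = i"
    using assms cluster_variable_position_unique by (intro the_equality) blast+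
  then show ?thesis by (simp add: parity_def)
qed

section \<open>Reduced mutation sequences\<close>

text \<open>The index is the direction of the last mutation, and no direction is repeated at once.
  The initial cluster is left out because it has no last direction.\<close>

inductive reduced_cluster :: "(3 \<Rightarrow> nat) \<Rightarrow> (3 \<Rightarrow> laurent fract) \<Rightarrow> 3 \<Rightarrow> bool" for k where
  first: "reduced_cluster k (mutation k i (\<lambda>j. to_fract (var j))) i"
| step: "reduced_cluster k C i \<Longrightarrow> j \<noteq> i \<Longrightarrow> reduced_cluster k (mutation k j C) j"

lemma mutation_involution:
  assumes "\<And>j. C j \<noteq> 0" "mutation k i C i \<noteq> 0"
  shows "mutation k i (mutation k i C) = C"
  using assms(1)[of i] assms(2) by (intro ext) (simp add: mutation_def)

lemma reduced_cluster_labeled: "reduced_cluster k C i \<Longrightarrow> C \<in> labeled_clusters k"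
  by (induction rule: reduced_cluster.induct) (auto intro: labeled_clusters.intros)

text \<open>A further mutation either extends a reduced sequence or, when it repeats the last
  direction, cancels the last mutation.\<close>

lemma labeled_cluster_reduced:
  assumes "C \<in> labeled_clusters k"
  shows "C = (\<lambda>j. to_fract (var j)) \<or> (\<exists>i. reduced_cluster k C i)"
  using assms
proof induction
  case (mutate C j)
  have inv: "mutation k j (mutation k j D) = D" if "D \<in> labeled_clusters k" for D
    using mutation_involution[OF labeled_cluster_nonzero[OF that]
        labeled_cluster_nonzero[OF labeled_clusters.mutate[OF that]]] .
  show ?case
  proof (cases "\<exists>i. i \<noteq> j \<and> reduced_cluster k C i")
    case True
    then show ?thesis using reduced_cluster.step by metis
  next
    case False
    show ?thesis
    proof (cases "C = (\<lambda>j. to_fract (var j))")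
      case True
      then show ?thesis using reduced_cluster.first by blast
    next
      case neq: False
      \<comment> \<open>The only case left is a repeated direction: the new mutation leads back to
        the initial cluster or to a shorter reduced sequence.\<close>
      with False mutate.IH have "reduced_cluster k C j" by metis
      then show ?thesis
      proof cases
        case first
        then show ?thesis using inv labeled_clusters.initial by simp
      next
        case (step D i)
        then show ?thesis using inv reduced_cluster_labeled by metis
      qed
    qed
  qed
qed simp

lemma mutation_val:
  assumes "\<And>j. fract_val (\<lambda>_. 1) (C j) (r j)" "\<And>j. r j > 0"
  shows "fract_val (\<lambda>_. 1) (mutation k i C j)
    (if j = i then ((r (i + 1))\<^sup>2 + of_nat (k i) * r (i + 1) * r (i + 2) + (r (i + 2))\<^sup>2) / r i
     else r j)"
proof -
  have "r i \<noteq> 0" using assms(2)[of i] by simp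
  then have "fract_val (\<lambda>_. 1)
     ((C (i + 1) * C (i + 1) + of_nat (k i) * C (i + 1) * C (i + 2) + C (i + 2) * C (i + 2)) / C i)
     ((r (i + 1) * r (i + 1) + of_nat (k i) * r (i + 1) * r (i + 2) + r (i + 2) * r (i + 2)) / r i)"
    by (intro fract_val_divide fract_val_add fract_val_mult fract_val_of_nat assms) auto
  then show ?thesis using assms(1) by (simp add: mutation_def power2_eq_square)
qed

text \<open>The numerator is at least the square of the larger of \<open>b\<close> and
  \<open>c\<close>, and it is divided by something smaller than that. This is the growth step of a
  Vieta jump.\<close>

lemma max_less_quotient:
  fixes a b c :: rat
  assumes "0 < a" "0 < b" "0 < c" "a < max b c" "0 \<le> K"
  shows "max b c < (b\<^sup>2 + K * b * c + c\<^sup>2) / a" 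
proof -
  have "max b c * a < max b c * max b c"
    using assms by (intro mult_strict_left_mono) auto
  also have "\<dots> \<le> b\<^sup>2 + K * b * c + c\<^sup>2"
    using assms by (auto simp: max_def power2_eq_square)
  finally show ?thesis using assms(1) by (simp add: pos_less_divide_eq del: max_less_iff_conj)
qed

text \<open>A reduced sequence never mutates the current maximum, so each new value exceeds both
  values that stay. At the start all values are 1 and the first new one is
  \<open>2 + k i\<close>.\<close>

lemma reduced_cluster_max:
  assumes "reduced_cluster k C i"
  shows "\<exists>r. \<forall>j. fract_val (\<lambda>_. 1) (C j) (r j) \<and> 0 < r j \<and> (j \<noteq> i \<longrightarrow> r j < r i)"
  using assms
proof induction
  case (first i)
  have v: "fract_val (\<lambda>_. 1) (to_fract (var j)) 1" for j
    using fract_val_to_fract[of "\<lambda>_. 1" "var j"] by (simp add: laurent_eval_var)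
  have "(2::rat) + of_nat (k i) > 1" by (simp add: add_pos_nonneg)
  moreover have "fract_val (\<lambda>_. 1) (mutation k i (\<lambda>j. to_fract (var j)) j)
    (if j = i then 2 + of_nat (k i) else 1)" for j
    using mutation_val[of "\<lambda>j. to_fract (var j)" "\<lambda>_. 1" k i j, OF v]
    by (cases "j = i") (simp_all add: add_ac)
  ultimately show ?case
    by (intro exI[of _ "\<lambda>j. if j = i then 2 + of_nat (k i) else 1"]) auto
next
  case (step C i j)
  then obtain r where r: "\<And>l. fract_val (\<lambda>_. 1) (C l) (r l)" "\<And>l. 0 < r l"
    "\<And>l. l \<noteq> i \<Longrightarrow> r l < r i" by blast
  let ?q = "((r (j + 1))\<^sup>2 + of_nat (k j) * r (j + 1) * r (j + 2) + (r (j + 2))\<^sup>2) / r j"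
  \<comment> \<open>Since \<open>j\<close> differs from \<open>i\<close>, the largest entry
    \<open>r i\<close> is one of the two that stay.\<close>
  have "r j < max (r (j + 1)) (r (j + 2))"
    using shift_exhaust[of i j] step.hyps r(3)[of j] by auto
  then have q: "max (r (j + 1)) (r (j + 2)) < ?q"
    using r(2) by (intro max_less_quotient) auto
  have "r l < ?q" if "l \<noteq> j" for l
    using shift_exhaust[of l j] that q by auto
  moreover have "0 < ?q" using q r(2)[of "j + 1"] by linarith
  moreover have "fract_val (\<lambda>_. 1) (mutation k j C l) (if l = j then ?q else r l)" for l
    using mutation_val[of C r k j l, OF r(1,2)] .
  ultimately show ?case
    using r(2) by (intro exI[of _ "\<lambda>l. if l = j then ?q else r l"]) simp
qed

section \<open>Triples of matrices with product \<open>T\<close>\<close>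

lemma mat22_nth [simp]:
  "mat22 a b c d $ 1 $ 1 = a" "mat22 a b c d $ 1 $ 2 = b"
  "mat22 a b c d $ 2 $ 1 = c" "mat22 a b c d $ 2 $ 2 = d"
  by (simp_all add: mat22_def)

lemma mat2_eq_iff:
  "(A :: mat2) = B \<longleftrightarrow>
     A$1$1 = B$1$1 \<and> A$1$2 = B$1$2 \<and> A$2$1 = B$2$1 \<and> A$2$2 = B$2$2"
  by (auto simp: vec_eq_iff forall_2)

lemma matrix_mult_nth:
  "((A :: mat2) ** B) $ i $ j = A$i$1 * B$1$j + A$i$2 * B$2$j"
  by (simp add: matrix_matrix_mult_def sum_2)

lemma mat_1_nth:
  "(mat 1 :: mat2) $ 1 $ 1 = 1" "(mat 1 :: mat2) $ 1 $ 2 = 0"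
  "(mat 1 :: mat2) $ 2 $ 1 = 0" "(mat 1 :: mat2) $ 2 $ 2 = 1"
  by (simp_all add: mat_def)

lemma trace_2: "trace (A :: mat2) = A$1$1 + A$2$2"
  by (simp add: trace_def sum_2)

abbreviation adj :: "mat2 \<Rightarrow> mat2" where
  "adj A \<equiv> mat22 (A$2$2) (- A$1$2) (- A$2$1) (A$1$1)"

text \<open>\<open>matrix_inv\<close> is defined by choice. The adjugate shows that an inverse
  exists, and a one-sided cancellation identifies the chosen one with it.\<close>

lemma matrix_inv_det_1:
  fixes A :: mat2
  assumes "det A = 1"
  shows "matrix_inv A = adj A"
proof -
  have 1: "A ** adj A = mat 1" "adj A ** A = mat 1"
    using assms by (simp_all add: mat2_eq_iff matrix_mult_nth mat_1_nth det_2 algebra_simps)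
  then have "A ** matrix_inv A = mat 1 \<and> matrix_inv A ** A = mat 1"
    unfolding matrix_inv_def by (rule_tac someI[of _ "adj A"]) simp
  then have 2: "A ** matrix_inv A = mat 1" by simp
  have "matrix_inv A = (adj A ** A) ** matrix_inv A" by (simp add: 1)
  also have "\<dots> = adj A" by (simp only: matrix_mul_assoc[symmetric] 2 matrix_mul_rid)
  finally show ?thesis .
qed

text \<open>The second form serves products nested to the right, the normal form used by the
  simplifier calls below.\<close>

lemma matrix_inv_left:
  fixes A :: mat2
  assumes "det A = 1"
  shows "matrix_inv A ** A = mat 1" "matrix_inv A ** (A ** B) = B"
proof -
  show 1: "matrix_inv A ** A = mat 1"
    using assms
    by (simp add: matrix_inv_det_1 mat2_eq_iff matrix_mult_nth mat_1_nth det_2 algebra_simps)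
  show "matrix_inv A ** (A ** B) = B" by (simp add: 1 matrix_mul_assoc)
qed

lemma matrix_inv_right:
  fixes A :: mat2
  assumes "det A = 1"
  shows "A ** matrix_inv A = mat 1" "A ** (matrix_inv A ** B) = B"
proof -
  show 1: "A ** matrix_inv A = mat 1"
    using assms
    by (simp add: matrix_inv_det_1 mat2_eq_iff matrix_mult_nth mat_1_nth det_2 algebra_simps)
  show "A ** (matrix_inv A ** B) = B" by (simp add: 1 matrix_mul_assoc)
qed

lemma det_matrix_inv: "det (A :: mat2) = 1 \<Longrightarrow> det (matrix_inv A) = 1"
  by (simp add: matrix_inv_det_1 det_2 algebra_simps)

lemma det_conj:
  fixes A :: mat2
  assumes "det A = 1"
  shows "det (A ** (B ** matrix_inv A)) = det B" "det (matrix_inv A ** (B ** A)) = det B"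
  using assms by (simp_all add: det_mul det_matrix_inv)

lemma trace_conj:
  fixes A :: mat2
  assumes "det A = 1"
  shows "trace (A ** (B ** matrix_inv A)) = trace B" "trace (matrix_inv A ** (B ** A)) = trace B"
proof -
  have "trace (A ** (B ** matrix_inv A)) = trace ((B ** matrix_inv A) ** A)"
    by (rule trace_mul_sym)
  then show "trace (A ** (B ** matrix_inv A)) = trace B"
    using assms by (simp add: matrix_mul_assoc[symmetric] matrix_inv_left)
  have "trace (matrix_inv A ** (B ** A)) = trace ((B ** A) ** matrix_inv A)"
    by (rule trace_mul_sym)
  then show "trace (matrix_inv A ** (B ** A)) = trace B"
    using assms by (simp add: matrix_mul_assoc[symmetric] matrix_inv_right)
qed

text \<open>These are the matrix equations of a CMM triple, with traces prescribed by
  \<open>p\<close> instead of by the parities of the \<open>(1,2)\<close>-entries. In this form they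
  pass to conjugated triples by matrix algebra alone.\<close>

definition sl2_triple :: "(3 \<Rightarrow> nat) \<Rightarrow> (3 \<Rightarrow> 3) \<Rightarrow> mat2 \<times> mat2 \<times> mat2 \<Rightarrow> bool" where
  "sl2_triple k p = (\<lambda>(X, Y, Z).
     det X = 1 \<and> det Y = 1 \<and> det Z = 1 \<and> X ** Y ** Z = T_mat k \<and>
     trace X = - of_nat (k (p 1)) \<and> trace Y = - of_nat (k (p 2)) \<and> trace Z = - of_nat (k (p 3)))"

text \<open>This inverts the left child map. The product is kept because Z cancels against its
  inverse, and conjugation keeps determinant and trace.\<close>

lemma sl2_triple_left:
  assumes "sl2_triple k p (X, Y, Z)"
  shows "sl2_triple k (p \<circ> Transposition.transpose 2 3) (X, Z, matrix_inv Z ** Y ** Z)"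
  using assms
  by (auto simp: sl2_triple_def det_conj trace_conj matrix_inv_left matrix_inv_right
      matrix_mul_assoc[symmetric])

lemma sl2_triple_right:
  assumes "sl2_triple k p (X, Y, Z)"
  shows "sl2_triple k (p \<circ> Transposition.transpose 1 2) (X ** Y ** matrix_inv X, X, Z)"
  using assms
  by (auto simp: sl2_triple_def det_conj trace_conj matrix_inv_left matrix_inv_right
      matrix_mul_assoc[symmetric])

text \<open>
  The computation rests on the identity, for \<open>A, B\<close> of determinant 1,
  \<open>(AB)\<^sub>1\<^sub>2 (BA)\<^sub>1\<^sub>2 - A\<^sub>1\<^sub>2 B\<^sub>1\<^sub>2 tr (AB) = A\<^sub>1\<^sub>2\<^sup>2 + B\<^sub>1\<^sub>2\<^sup>2\<close>.
\<close>

lemma entry_left: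
  assumes "sl2_triple k p (X, Y, Z)"
  shows "Z$1$2 * (Y ** Z ** matrix_inv Y)$1$2 =
    (X$1$2)\<^sup>2 + of_nat (k (p 3)) * X$1$2 * Y$1$2 + (Y$1$2)\<^sup>2"
proof -
  have dX: "det X = 1" and dY: "det Y = 1" and dZ: "det Z = 1"
    and T: "X ** Y ** Z = T_mat k" and tZ: "trace Z = - of_nat (k (p 3))"
    using assms by (auto simp: sl2_triple_def)
  define M where "M = markov k"
  \<comment> \<open>Solving \<open>X ** Y ** Z = T_mat k\<close> for \<open>Z\<close> expresses both
    \<open>Z\<close> and its conjugate through \<open>X\<close>, \<open>Y\<close> and the entry
    \<open>M\<close>.\<close>
  have Z: "Z = adj Y ** (adj X ** T_mat k)"
    using dX dY
    by (simp add: T[symmetric] matrix_inv_det_1[symmetric] matrix_mul_assoc[symmetric] matrix_inv_left)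
  have W: "Y ** Z ** matrix_inv Y = adj X ** T_mat k ** adj Y"
    unfolding Z using dX dY
    by (simp add: matrix_inv_det_1[symmetric] matrix_mul_assoc[symmetric] matrix_inv_right)
  have tm: "T_mat k$1$1 = -1" "T_mat k$1$2 = 0" "T_mat k$2$1 = M" "T_mat k$2$2 = -1"
    by (simp_all add: T_mat_def M_def)
  obtain a b c d where X: "X$1$1 = a" "X$1$2 = b" "X$2$1 = c" "X$2$2 = d" by blast
  obtain e f g h where Y: "Y$1$1 = e" "Y$1$2 = f" "Y$2$1 = g" "Y$2$2 = h" by blast
  have 1: "Z$1$2 = a * f + b * h"
    by (simp add: Z matrix_mult_nth tm X Y)
  have 2: "(Y ** Z ** matrix_inv Y)$1$2 = b * e + d * f + M * b * f"
    unfolding W by (simp add: matrix_mult_nth tm X Y algebra_simps)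
  have 3: "of_nat (k (p 3)) = M * (a * f + b * h) + (a * e + b * g + c * f + d * h)"
    using tZ by (simp add: trace_2 Z matrix_mult_nth tm X Y algebra_simps)
  \<comment> \<open>The three formulas read \<open>(XY)\<^sub>1\<^sub>2\<close>,
    \<open>(YX)\<^sub>1\<^sub>2 + M b f\<close> and \<open>M (XY)\<^sub>1\<^sub>2 + tr (XY)\<close>.
    The terms with \<open>M\<close> cancel, and the identity stated above remains for
    \<open>A = X\<close>, \<open>B = Y\<close>.\<close>
  have "a * d = 1 + b * c" "e * h = 1 + f * g"
    using dX dY by (simp_all add: det_2 X Y algebra_simps)
  then show ?thesis
    unfolding 1 2 3 X Y power2_eq_square by algebra
qed

text \<open>The mirror image: now \<open>X\<close> is eliminated, and the same identity is used for
  \<open>A = Y\<close>, \<open>B = Z\<close>.\<close>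

lemma entry_right:
  assumes "sl2_triple k p (X, Y, Z)"
  shows "X$1$2 * (matrix_inv Y ** X ** Y)$1$2 =
    (Y$1$2)\<^sup>2 + of_nat (k (p 1)) * Y$1$2 * Z$1$2 + (Z$1$2)\<^sup>2"
proof -
  have dY: "det Y = 1" and dZ: "det Z = 1" and dX: "det X = 1"
    and T: "X ** Y ** Z = T_mat k" and tX: "trace X = - of_nat (k (p 1))"
    using assms by (auto simp: sl2_triple_def)
  define M where "M = markov k"
  have X: "X = T_mat k ** adj Z ** adj Y"
    using dY dZ
    by (simp add: T[symmetric] matrix_inv_det_1[symmetric] matrix_mul_assoc[symmetric] matrix_inv_right)
  have W: "matrix_inv Y ** X ** Y = adj Y ** T_mat k ** adj Z"
    unfolding X using dY dZ
    by (simp add: matrix_inv_det_1[symmetric] matrix_mul_assoc[symmetric] matrix_inv_left)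
  have tm: "T_mat k$1$1 = -1" "T_mat k$1$2 = 0" "T_mat k$2$1 = M" "T_mat k$2$2 = -1"
    by (simp_all add: T_mat_def M_def)
  obtain a b c d where Z: "Z$1$1 = a" "Z$1$2 = b" "Z$2$1 = c" "Z$2$2 = d" by blast
  obtain e f g h where Y: "Y$1$1 = e" "Y$1$2 = f" "Y$2$1 = g" "Y$2$2 = h" by blast
  have 1: "X$1$2 = e * b + f * d"
    by (simp add: X matrix_mult_nth tm Z Y algebra_simps)
  have 2: "(matrix_inv Y ** X ** Y)$1$2 = b * h + a * f + M * b * f"
    unfolding W by (simp add: matrix_mult_nth tm Z Y algebra_simps)
  have 3: "of_nat (k (p 1)) = M * (e * b + f * d) + (a * e + b * g + c * f + d * h)"
    using tX by (simp add: trace_2 X matrix_mult_nth tm Z Y algebra_simps)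
  have "a * d = 1 + b * c" "e * h = 1 + f * g"
    using dZ dY by (simp_all add: det_2 Z Y algebra_simps)
  then show ?thesis
    unfolding 1 2 3 Z Y power2_eq_square by algebra
qed

text \<open>The mutation rule is applied to the triple one step back, whose left child has middle
  matrix \<open>Y\<close>.\<close>

lemma entry_middle_left:
  assumes "sl2_triple k p (X, Y, Z)"
  shows "Y$1$2 * (matrix_inv Z ** Y ** Z)$1$2 =
    (X$1$2)\<^sup>2 + of_nat (k (p 2)) * X$1$2 * Z$1$2 + (Z$1$2)\<^sup>2"
proof -
  have "det Z = 1" using assms by (simp add: sl2_triple_def)
  then have "Z ** (matrix_inv Z ** Y ** Z) ** matrix_inv Z = Y"
    by (simp add: matrix_mul_assoc[symmetric] matrix_inv_right matrix_inv_left)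
  with entry_left[OF sl2_triple_left[OF assms]] show ?thesis
    by (simp add: mult.commute)
qed

lemma entry_middle_right:
  assumes "sl2_triple k p (X, Y, Z)"
  shows "Y$1$2 * (X ** Y ** matrix_inv X)$1$2 =
    (X$1$2)\<^sup>2 + of_nat (k (p 2)) * X$1$2 * Z$1$2 + (Z$1$2)\<^sup>2"
proof -
  have "det X = 1" using assms by (simp add: sl2_triple_def)
  then have "matrix_inv X ** (X ** Y ** matrix_inv X) ** X = Y"
    by (simp add: matrix_mul_assoc[symmetric] matrix_inv_right matrix_inv_left)
  with entry_right[OF sl2_triple_right[OF assms]] show ?thesis
    by (simp add: mult.commute)
qed

text \<open>The traces give the upper left entries of \<open>Y\<close> and \<open>Z\<close> from the
  lower right ones, the determinants give the lower left entries, and the first row of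
  \<open>X ** Y\<close> gives the rest in terms of \<open>X$1$1\<close>.\<close>

lemma sl2_triple_init:
  assumes "sl2_triple k p (X, Y, Z)"
    and "X$1$2 = var (p 1)" "Y$1$2 = var (p 2)" "Z$1$2 = var (p 3)"
  shows "(X, Y, Z) = (X_init k p (X$1$1), Y_init k p (X$1$1), Z_init k p (X$1$1))"
proof -
  have d: "det X = 1" "det Y = 1" "det Z = 1"
    and T: "X ** Y ** Z = T_mat k"
    and tr: "trace X = - of_nat (k (p 1))" "trace Y = - of_nat (k (p 2))" "trace Z = - of_nat (k (p 3))"
    using assms(1) by (auto simp: sl2_triple_def)
  have eq: "X ** Y = T_mat k ** adj Z"
    using d(3)
    by (simp add: T[symmetric] matrix_inv_det_1[symmetric] matrix_mul_assoc[symmetric] matrix_inv_right)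
  \<comment> \<open>The determinant fixes the lower left entry because \<open>var i\<close> is a
    unit.\<close>
  have sl2_eq: "A = sl2_with (A$1$1) i (A$2$2)" if "det A = 1" "A$1$2 = var i" for A i
  proof -
    have "var i * A$2$1 = A$1$1 * A$2$2 - 1"
      using that by (simp add: det_2 algebra_simps)
    then have "(A$1$1 * A$2$2 - 1) * var_inv i = A$2$1"
      using var_mult_var_inv[of i] by algebra
    then show ?thesis using that by (simp add: mat2_eq_iff sl2_with_def)
  qed
  define f where "f = X$1$1"
  let ?y1 = "var (p 1)" and ?y2 = "var (p 2)" and ?y3 = "var (p 3)"
  let ?i1 = "var_inv (p 1)" and ?i2 = "var_inv (p 2)"
  let ?k2 = "of_nat (k (p 2)) :: laurent" and ?k3 = "of_nat (k (p 3)) :: laurent"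
  have unit: "x = z * v" if "u * v = 1" "u * x = z" for u v x z :: laurent
  proof -
    have "z * v = (u * v) * x" unfolding that(2)[symmetric] by (simp only: mult_ac)
    then show ?thesis by (simp add: that(1))
  qed
  have i: "?y1 * ?i1 = 1" "?y2 * ?i2 = 1" by (rule var_mult_var_inv)+
  have X22: "X$2$2 = - f - of_nat (k (p 1))"
    using tr(1) unfolding trace_2 f_def by algebra
  have Y11: "Y$1$1 = - ?k2 - Y$2$2"
    using tr(2) unfolding trace_2 by algebra
  have Z11: "Z$1$1 = - ?k3 - Z$2$2"
    using tr(3) unfolding trace_2 by algebra
  \<comment> \<open>The first row of \<open>T_mat k\<close> is (-1, 0), so the first row of
    \<open>X ** Y\<close> is the negated first row of the adjugate of \<open>Z\<close>.\<close>
  have "(X ** Y)$1$2 = ?y3" "(X ** Y)$1$1 = - Z$2$2"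
    unfolding eq by (simp_all add: matrix_mult_nth T_mat_def assms)
  then have e: "f * ?y2 + ?y1 * Y$2$2 = ?y3" "f * Y$1$1 + ?y1 * Y$2$1 = - Z$2$2"
    by (simp_all add: matrix_mult_nth f_def assms)
  have dY: "Y$1$1 * Y$2$2 - ?y2 * Y$2$1 = 1"
    using d(2) by (simp add: det_2 assms)
  have Y22: "Y$2$2 = (- (f * ?y2) + ?y3) * ?i1"
    using e(1) by (intro unit[OF i(1)]) (simp add: algebra_simps)
  have Y11': "Y$1$1 = (f * ?y2 - ?k2 * ?y1 - ?y3) * ?i1"
    using e(1) by (intro unit[OF i(1)]) (simp add: Y11 algebra_simps)
  have i12: "(?y1 * ?y2) * (?i1 * ?i2) = 1"
  proof -
    have "(?y1 * ?y2) * (?i1 * ?i2) = (?y1 * ?i1) * (?y2 * ?i2)" by (simp only: mult_ac)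
    then show ?thesis by (simp add: i)
  qed
  have Z22': "?y1 * ?y2 * Z$2$2 = - (f * ?y2 * ?y3) + ?k2 * ?y1 * ?y3 + ?y1\<^sup>2 + ?y3\<^sup>2"
  proof -
    \<comment> \<open>The entry \<open>c\<close> is eliminated through the determinant of the second
      matrix, which produces the square of \<open>y1\<close>; the square of \<open>y3\<close> comes
      from \<open>y1 * d = y3 - f * y2\<close>.\<close>
    have *: "y1 * y2 * z = - (f * y2 * y3) + l * y1 * y3 + y1\<^sup>2 + y3\<^sup>2"
      if "f * y2 + y1 * d = y3" "f * a + y1 * c = - z" "a * d - y2 * c = 1" "a = - l - d"
      for y1 y2 y3 a c d f l z :: laurent
    proof -
      have "z = - (f * a + y1 * c)" using that(2) by simp
      then have "y1 * y2 * z = y1 * y2 * - (f * a + y1 * c)" by simp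
      also have "\<dots> = - (f * a * y1 * y2) - y1 * y1 * (y2 * c)"
        by (simp add: algebra_simps)
      also have "y2 * c = a * d - 1" using that(3) by (simp add: algebra_simps)
      also have "- (f * a * y1 * y2) - y1 * y1 * (a * d - 1) = y1 * y1 - a * y1 * (f * y2 + y1 * d)"
        by (simp add: algebra_simps)
      also have "\<dots> = y1 * y1 + l * y1 * y3 + (y1 * d) * y3"
        unfolding that(1) that(4) by (simp add: algebra_simps)
      also have "y1 * d = y3 - f * y2" using that(1) by (simp add: algebra_simps)
      finally show ?thesis by (simp add: algebra_simps power2_eq_square)
    qed
    show ?thesis using * e dY Y11 by blast
  qed
  from unit[OF i12 this]
  have Z22: "Z$2$2 = (- (f * ?y2 * ?y3) + ?k2 * ?y1 * ?y3 + ?y1\<^sup>2 + ?y3\<^sup>2) * (?i1 * ?i2)" .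
  have Z11': "Z$1$1 = (f * ?y2 * ?y3 - ?k3 * ?y1 * ?y2 - ?k2 * ?y1 * ?y3 - ?y1\<^sup>2 - ?y3\<^sup>2) * (?i1 * ?i2)"
  proof -
    have "?y1 * ?y2 * Z$1$1 = f * ?y2 * ?y3 - ?k3 * ?y1 * ?y2 - ?k2 * ?y1 * ?y3 - ?y1\<^sup>2 - ?y3\<^sup>2"
      using Z22' by (simp add: Z11 algebra_simps)
    then show ?thesis
      using i12 by (rule unit[rotated])
  qed
  show ?thesis
    using sl2_eq[OF d(1) assms(2)] sl2_eq[OF d(2) assms(3)] sl2_eq[OF d(3) assms(4)]
    unfolding X_init_def Y_init_def Z_init_def Let_def X22 Y11' Y22 Z11' Z22 f_def[symmetric]
    by simp
qed

section \<open>The tree\<close>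

lemma perm3_distinct:
  assumes "p permutes (UNIV :: 3 set)"
  shows "p 1 \<noteq> p 2" "p 1 \<noteq> p 3" "p 2 \<noteq> p 3"
  using permutes_inj[OF assms] by (simp_all add: inj_eq)

lemma perm3_exhaust:
  assumes "p permutes (UNIV :: 3 set)"
  shows "i = p 1 \<or> i = p 2 \<or> i = p 3"
  using permutes_surj[OF assms] exhaust_3 by (metis surjD)

text \<open>Positions 1 and 3 are the ones that the outer matrices of a root reveal.\<close>

lemma perm3_eqI:
  assumes "p permutes (UNIV :: 3 set)" "q permutes (UNIV :: 3 set)" "p 1 = q 1" "p 3 = q 3"
  shows "p = q"
proof -
  have "p 2 = q 2"
    using perm3_exhaust[OF assms(2), of "p 2"] perm3_distinct[OF assms(1)] assms(3,4) by auto
  then show ?thesis using assms(3,4) exhaust_3 by (metis ext)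
qed

lemma perm3_comp_transpose:
  assumes "p permutes (UNIV :: 3 set)"
  shows "(p \<circ> Transposition.transpose i j) permutes UNIV"
  using assms by (intro permutes_compose permutes_swap_id) auto

text \<open>The numerator is symmetric in the two other positions, so they may be named in either
  order, as a permutation requires.\<close>

lemma mutation_eq:
  assumes "j \<noteq> i" "l \<noteq> i" "j \<noteq> l"
  shows "mutation k i C i = ((C j)\<^sup>2 + of_nat (k i) * C j * C l + (C l)\<^sup>2) / C i"
proof -
  have "j = i + 1 \<and> l = i + 2 \<or> j = i + 2 \<and> l = i + 1"
    using shift_exhaust[of j i] shift_exhaust[of l i] assms by auto
  then show ?thesis by (auto simp: mutation_def algebra_simps)
qed

lemma mutation_other: "j \<noteq> i \<Longrightarrow> mutation k i C j = C j"
  by (simp add: mutation_def)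

lemma var_inj: "var i = var j \<Longrightarrow> i = j"
  unfolding var_def by (metis lookup_single_eq lookup_single_not_eq zero_neq_one)

lemma X_init_nth: "X_init k \<sigma> f $ 1 $ 1 = f" "X_init k \<sigma> f $ 1 $ 2 = var (\<sigma> 1)"
  and Y_init_nth: "Y_init k \<sigma> f $ 1 $ 2 = var (\<sigma> 2)"
  and Z_init_nth: "Z_init k \<sigma> f $ 1 $ 2 = var (\<sigma> 3)"
  by (simp_all add: X_init_def Y_init_def Z_init_def sl2_with_def Let_def)

lemma val_one_simps:
  "val_one (p + q) = val_one p + val_one q" "val_one (p * q) = val_one p * val_one q"
  "val_one (of_nat n) = of_nat n" "val_one (var i) = 1" "val_one (p ^ m) = val_one p ^ m"
proof -
  show mult: "val_one (p * q) = val_one p * val_one q" for p q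
    by (simp add: val_one_def laurent_eval_mult)
  show "val_one (p ^ m) = val_one p ^ m"
    by (induction m) (simp_all add: mult, simp add: val_one_def laurent_eval_one)
qed (simp_all add: val_one_def laurent_eval_add laurent_eval_of_nat laurent_eval_var)

lemma cmm_tree_Nil: "cmm_tree k \<sigma> f [] = cmm_root k \<sigma> f"
  by (simp add: cmm_tree_def)

lemma cmm_tree_snoc: "cmm_tree k \<sigma> f (v @ [d]) = cmm_child d (cmm_tree k \<sigma> f v)"
  by (simp add: cmm_tree_def)

text \<open>This and its mirror image serve existence: a triple is a child of the triple one step
  back. The converse lemmas \<open>parent_left\<close> and \<open>parent_right\<close> serve
  uniqueness.\<close>

lemma child_left_inv:
  assumes "det Z = 1"
  shows "cmm_child Left (X, Z, matrix_inv Z ** Y ** Z) = (X, Y, Z)"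
  using assms by (simp add: matrix_mul_assoc[symmetric] matrix_inv_right)

lemma child_right_inv:
  assumes "det X = 1"
  shows "cmm_child Right (X ** Y ** matrix_inv X, X, Z) = (X, Y, Z)"
  using assms by (simp add: matrix_mul_assoc[symmetric] matrix_inv_left)

lemma parent_left:
  assumes "cmm_child Left t = (X, Y, Z)" "det Z = 1"
  shows "t = (X, Z, matrix_inv Z ** Y ** Z)"
  using assms by (cases t) (auto simp: matrix_mul_assoc[symmetric] matrix_inv_left)

lemma parent_right:
  assumes "cmm_child Right t = (X, Y, Z)" "det X = 1"
  shows "t = (X ** Y ** matrix_inv X, X, Z)"
  using assms by (cases t) (auto simp: matrix_mul_assoc[symmetric] matrix_inv_right)

section \<open>Existence of the vertex\<close>

text \<open>Descent along the reduced sequence: the middle matrix carries the last mutated variable,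
  and a conjugation undoes that mutation. \<open>p\<close> records the positions in the cluster of
  the three \<open>(1,2)\<close>-entries.\<close>

lemma reduced_cluster_in_tree:
  assumes "reduced_cluster k C i" "p permutes UNIV" "p 2 = i" "sl2_triple k p (X, Y, Z)"
    "to_fract (X$1$2) = C (p 1)" "to_fract (Y$1$2) = C (p 2)" "to_fract (Z$1$2) = C (p 3)"
  shows "\<exists>f \<sigma> v. \<sigma> permutes UNIV \<and> cmm_tree k \<sigma> f v = (X, Y, Z)"
proof -
  \<comment> \<open>The exchange relation determines the variable before mutation, as the nonzero
    \<open>D (p 2)\<close> can be cancelled.\<close>
  have middle: "to_fract w = C (p 2)"
    if p: "p permutes UNIV" and D: "D = mutation k (p 2) C" and C: "C \<in> labeled_clusters k"
      and eq: "to_fract x = D (p 1)" "to_fract y = D (p 2)" "to_fract z = D (p 3)"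
      and w: "y * w = x\<^sup>2 + of_nat (k (p 2)) * x * z + z\<^sup>2"
    for C D p w x y z
  proof -
    have of_nat: "to_fract (of_nat n :: laurent) = of_nat n" for n by (induction n) auto
    have "D \<in> labeled_clusters k" unfolding D by (rule labeled_clusters.mutate[OF C])
    then have nz: "D (p 2) \<noteq> 0" "C (p 2) \<noteq> 0" using labeled_cluster_nonzero C by blast+
    have "D (p 2) = ((C (p 1))\<^sup>2 + of_nat (k (p 2)) * C (p 1) * C (p 3) + (C (p 3))\<^sup>2) / C (p 2)"
      unfolding D using perm3_distinct[OF p] by (intro mutation_eq) auto
    then have "D (p 2) * C (p 2) =
        (D (p 1))\<^sup>2 + of_nat (k (p 2)) * D (p 1) * D (p 3) + (D (p 3))\<^sup>2"
      using nz(2) perm3_distinct[OF p] by (simp add: D mutation_other)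
    also have "\<dots> = to_fract (y * w)"
      unfolding w by (simp add: of_nat power2_eq_square eq)
    also have "\<dots> = D (p 2) * to_fract w" by (simp add: eq)
    finally show ?thesis using nz(1) by simp
  qed
  show ?thesis
    using assms
  proof (induction arbitrary: p X Y Z)
    case (first i)
    let ?C = "\<lambda>j. to_fract (var j)" and ?W = "matrix_inv Z ** Y ** Z"
    \<comment> \<open>This is the \<tau> of \<open>cmm_root\<close> for \<open>\<sigma> = p\<close>.
      Conjugating by \<open>Z\<close> leads to a triple over the initial cluster, which makes
      \<open>(X, Y, Z)\<close> the root with \<open>f = X$1$1\<close>.\<close>
    let ?p = "p \<circ> Transposition.transpose 2 3"
    have "det Z = 1" using first by (simp add: sl2_triple_def)
    have "to_fract (?W$1$2) = ?C (p 2)"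
      using first labeled_clusters.initial entry_middle_left
      by (intro middle[of p "mutation k (p 2) ?C" ?C "X$1$2" "Y$1$2" "Z$1$2"]) auto
    moreover have "to_fract (X$1$2) = ?C (p 1)" "to_fract (Z$1$2) = ?C (p 3)"
      using first perm3_distinct[OF first(1)] by (auto simp: mutation_other)
    ultimately have "(X, Z, ?W) = (X_init k ?p (X$1$1), Y_init k ?p (X$1$1), Z_init k ?p (X$1$1))"
      using sl2_triple_left[OF first(3)] by (intro sl2_triple_init) simp_all
    moreover have "Z ** ?W ** matrix_inv Z = Y"
      using child_left_inv[OF \<open>det Z = 1\<close>, of X Y] by simp
    ultimately have "cmm_root k p (X$1$1) = (X, Y, Z)"
      by (simp add: cmm_root_def Let_def) metis
    then show ?case using first(1) cmm_tree_Nil by metis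
  next
    case (step C i j)
    note p = step.prems(1) and t = step.prems(3)
    have dets: "det X = 1" "det Z = 1" using t by (simp_all add: sl2_triple_def)
    have C: "C \<in> labeled_clusters k" using step.hyps reduced_cluster_labeled by blast
    have XZ: "to_fract (X$1$2) = C (p 1)" "to_fract (Z$1$2) = C (p 3)"
      using step.prems perm3_distinct[OF p] by (auto simp: mutation_other)
    have D: "mutation k j C = mutation k (p 2) C" using step.prems by simp
    note mid = middle[OF p D C step.prems(4-6)]
    \<comment> \<open>The triple one step back must have direction \<open>i\<close> in the middle.
      Hence \<open>X\<close> moves there in the first case, making the present vertex a right child,
      and \<open>Z\<close> in the second, making it a left child.\<close>
    have "i = p 1 \<or> i = p 3" using step perm3_exhaust[OF p, of i] by auto
    then show ?case
    proof
      assume i: "i = p 1"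
      obtain f \<sigma> v where "\<sigma> permutes UNIV" and
        v: "cmm_tree k \<sigma> f v = (X ** Y ** matrix_inv X, X, Z)"
        using step.IH[OF perm3_comp_transpose[OF p] _ sl2_triple_right[OF t]]
          i XZ mid[OF entry_middle_right[OF t]] by auto
      moreover have "cmm_tree k \<sigma> f (v @ [Right]) = (X, Y, Z)"
        unfolding cmm_tree_snoc v by (rule child_right_inv[OF dets(1)])
      ultimately show ?thesis by blast
    next
      assume i: "i = p 3"
      obtain f \<sigma> v where "\<sigma> permutes UNIV" and
        v: "cmm_tree k \<sigma> f v = (X, Z, matrix_inv Z ** Y ** Z)"
        using step.IH[OF perm3_comp_transpose[OF p] _ sl2_triple_left[OF t]]
          i XZ mid[OF entry_middle_left[OF t]] by auto
      moreover have "cmm_tree k \<sigma> f (v @ [Left]) = (X, Y, Z)"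
        unfolding cmm_tree_snoc v by (rule child_left_inv[OF dets(2)])
      ultimately show ?thesis by blast
    qed
  qed
qed

section \<open>Uniqueness of the vertex\<close>

text \<open>The middle value of the parent is its maximum and becomes the third value of a left
  child and the first of a right child. The matrix equations are assumed at the vertex and carried
  up to its ancestors, so the word is read from its end.\<close>

lemma cmm_tree_val:
  assumes "cmm_tree k \<sigma> f v = (X, Y, Z)" "sl2_triple k p (X, Y, Z)"
  defines "x \<equiv> val_one (X$1$2)" and "y \<equiv> val_one (Y$1$2)" and "z \<equiv> val_one (Z$1$2)"
  shows "0 < x \<and> 0 < z \<and> max x z < y \<and>
    (if v = [] then x = z else if last v = Left then x < z else z < x)"
  using assms(1,2) unfolding x_def y_def z_def
proof (induction v arbitrary: p X Y Z rule: rev_induct)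
  case Nil
  let ?W = "matrix_inv Z ** Y ** Z" and ?\<tau> = "\<sigma> \<circ> Transposition.transpose 2 3"
  have dZ: "det Z = 1" using Nil by (simp add: sl2_triple_def)
  \<comment> \<open>The root is itself a left child of a triple over the initial cluster, whose
    entries all have value 1.\<close>
  have root: "(X, Y, Z) = cmm_child Left (X_init k ?\<tau> f, Y_init k ?\<tau> f, Z_init k ?\<tau> f)"
    using Nil(1) by (auto simp: cmm_tree_Nil cmm_root_def Let_def)
  have "(X_init k ?\<tau> f, Y_init k ?\<tau> f, Z_init k ?\<tau> f) = (X, Z, ?W)"
    by (rule parent_left[OF root[symmetric] dZ])
  then have "X$1$2 = var (?\<tau> 1)" "Z$1$2 = var (?\<tau> 2)" "?W$1$2 = var (?\<tau> 3)"
    using X_init_nth(2) Y_init_nth Z_init_nth by (metis prod.inject)+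
  then have 1: "val_one (X$1$2) = 1" "val_one (Z$1$2) = 1" "val_one (?W$1$2) = 1"
    by (simp_all only: val_one_simps)
  have "val_one (Y$1$2) = 2 + of_nat (k (p 2))"
    using arg_cong[OF entry_middle_left[OF Nil(2)], of val_one] by (simp add: val_one_simps 1)
  moreover have "(2::rat) + of_nat (k (p 2)) > 1" by (simp add: add_pos_nonneg)
  ultimately show ?case using 1 by simp
next
  case (snoc d v)
  have dets: "det X = 1" "det Z = 1" using snoc.prems by (simp_all add: sl2_triple_def)
  show ?case
  proof (cases d)
    case Left
    let ?W = "matrix_inv Z ** Y ** Z"
    have "cmm_tree k \<sigma> f v = (X, Z, ?W)"
      using snoc.prems(1) Left by (intro parent_left dets) (simp add: cmm_tree_snoc)
    from snoc.IH[OF this sl2_triple_left[OF snoc.prems(2)]]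
    have *: "0 < val_one (X$1$2)" "0 < val_one (?W$1$2)"
      "val_one (X$1$2) < val_one (Z$1$2)" "val_one (?W$1$2) < val_one (Z$1$2)" by auto
    then have "max (val_one (X$1$2)) (val_one (Z$1$2)) < ((val_one (X$1$2))\<^sup>2 +
      of_nat (k (p 2)) * val_one (X$1$2) * val_one (Z$1$2) + (val_one (Z$1$2))\<^sup>2) / val_one (?W$1$2)"
      by (intro max_less_quotient) auto
    also have "\<dots> = val_one (Y$1$2)"
      using arg_cong[OF entry_middle_left[OF snoc.prems(2)], of val_one] *(2)
      by (simp add: val_one_simps field_simps)
    finally show ?thesis using * Left by auto
  next
    case Right
    let ?W = "X ** Y ** matrix_inv X"
    have "cmm_tree k \<sigma> f v = (?W, X, Z)"
      using snoc.prems(1) Right by (intro parent_right dets) (simp add: cmm_tree_snoc)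
    from snoc.IH[OF this sl2_triple_right[OF snoc.prems(2)]]
    have *: "0 < val_one (?W$1$2)" "0 < val_one (Z$1$2)"
      "val_one (?W$1$2) < val_one (X$1$2)" "val_one (Z$1$2) < val_one (X$1$2)" by auto
    then have "max (val_one (X$1$2)) (val_one (Z$1$2)) < ((val_one (X$1$2))\<^sup>2 +
      of_nat (k (p 2)) * val_one (X$1$2) * val_one (Z$1$2) + (val_one (Z$1$2))\<^sup>2) / val_one (?W$1$2)"
      by (intro max_less_quotient) auto
    also have "\<dots> = val_one (Y$1$2)"
      using arg_cong[OF entry_middle_right[OF snoc.prems(2)], of val_one] *(1)
      by (simp add: val_one_simps field_simps)
    finally show ?thesis using * Right by auto
  qed
qed

text \<open>The first matrix of a root shows \<open>f\<close> and \<open>\<sigma> 1\<close>, the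
  third one shows \<open>\<sigma> 3\<close>.\<close>

lemma cmm_root_inj:
  assumes "\<sigma> permutes UNIV" "\<sigma>' permutes UNIV" "cmm_root k \<sigma> f = cmm_root k \<sigma>' f'"
  shows "\<sigma> = \<sigma>' \<and> f = f'"
proof -
  let ?t = "Transposition.transpose (2::3) 3"
  have X: "X_init k (\<sigma> \<circ> ?t) f = X_init k (\<sigma>' \<circ> ?t) f'"
    and Y: "Y_init k (\<sigma> \<circ> ?t) f = Y_init k (\<sigma>' \<circ> ?t) f'"
    using assms(3) by (simp_all add: cmm_root_def Let_def)
  have "var ((\<sigma> \<circ> ?t) 1) = var ((\<sigma>' \<circ> ?t) 1)" "var ((\<sigma> \<circ> ?t) 2) = var ((\<sigma>' \<circ> ?t) 2)"
    using X Y X_init_nth(2) Y_init_nth by metis+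
  then have "\<sigma> 1 = \<sigma>' 1" "\<sigma> 3 = \<sigma>' 3" by (auto dest: var_inj)
  moreover have "f = f'" using X X_init_nth(1) by metis
  ultimately show ?thesis using perm3_eqI assms by blast
qed

text \<open>The outer values decide whether both words are empty and, if not, which last letter they
  share. Removing it leaves two words for the same parent triple.\<close>

lemma cmm_tree_inj:
  assumes "\<sigma> permutes UNIV" "\<sigma>' permutes UNIV"
    and "cmm_tree k \<sigma> f v = (X, Y, Z)" "cmm_tree k \<sigma>' f' v' = (X, Y, Z)"
    and "sl2_triple k p (X, Y, Z)"
  shows "\<sigma> = \<sigma>' \<and> f = f' \<and> v = v'"
  using assms(3-)
proof (induction v arbitrary: p X Y Z v' rule: rev_induct)
  case Nil
  have "v' = []"
    using cmm_tree_val[OF Nil(1,3)] cmm_tree_val[OF Nil(2,3)] by (auto split: if_splits)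
  then have "cmm_root k \<sigma> f = cmm_root k \<sigma>' f'"
    using Nil by (simp add: cmm_tree_Nil)
  from cmm_root_inj[OF assms(1,2) this] \<open>v' = []\<close> show ?case by simp
next
  case (snoc d v)
  note val = cmm_tree_val[OF snoc.prems(1,3)] cmm_tree_val[OF snoc.prems(2,3)]
  have dets: "det X = 1" "det Z = 1" using snoc.prems by (simp_all add: sl2_triple_def)
  have "v' \<noteq> []" using val by (auto split: if_splits)
  then obtain w d' where v': "v' = w @ [d']" by (metis rev_exhaust)
  have d': "d' = d"
    using val unfolding v' by (cases d; cases d') auto
  show ?case
  proof (cases d)
    case Left
    have "cmm_tree k \<sigma> f v = (X, Z, matrix_inv Z ** Y ** Z)"
      "cmm_tree k \<sigma>' f' w = (X, Z, matrix_inv Z ** Y ** Z)"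
      using snoc.prems Left v' d' by (auto intro!: parent_left dets simp: cmm_tree_snoc)
    from snoc.IH[OF this sl2_triple_left[OF snoc.prems(3)]] show ?thesis
      by (simp add: v' d')
  next
    case Right
    have "cmm_tree k \<sigma> f v = (X ** Y ** matrix_inv X, X, Z)"
      "cmm_tree k \<sigma>' f' w = (X ** Y ** matrix_inv X, X, Z)"
      using snoc.prems Right v' d' by (auto intro!: parent_right dets simp: cmm_tree_snoc)
    from snoc.IH[OF this sl2_triple_right[OF snoc.prems(3)]] show ?thesis
      by (simp add: v' d')
  qed
qed

theorem theorem5p9:
  fixes k :: "3 \<Rightarrow> nat" and X Y Z :: mat2 and a b c :: laurent
  assumes "cmm_associated k (X, Y, Z) (a, b, c)"
    and "val_one b > max (val_one a) (val_one c)"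
  shows "\<exists>!(f :: laurent, \<sigma> :: 3 \<Rightarrow> 3, v :: direction list).
           \<sigma> permutes UNIV \<and> cmm_tree k \<sigma> f v = (X, Y, Z)"
proof -
  have cmm: "cmm_triple k (X, Y, Z)" and abc: "X$1$2 = a" "Y$1$2 = b" "Z$1$2 = c"
    using assms(1) by (auto simp: cmm_associated_def)
  then obtain C p where C: "C \<in> labeled_clusters k" and p: "p permutes UNIV"
    and entries: "to_fract (X$1$2) = C (p 1)" "to_fract (Y$1$2) = C (p 2)" "to_fract (Z$1$2) = C (p 3)"
    by (auto simp: cmm_triple_def nonlabeled_clusters_def)
  \<comment> \<open>Unique positions turn the parity of each \<open>(1,2)\<close>-entry into the
    value of \<open>k\<close> at its position.\<close>
  have t: "sl2_triple k p (X, Y, Z)"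
    using cmm by (auto simp: cmm_triple_def cmm_matrix_def sl2_triple_def entries parity_cluster[OF C])
  have val: "fract_val (\<lambda>_. 1) (C (p 1)) (val_one a)" "fract_val (\<lambda>_. 1) (C (p 2)) (val_one b)"
    "fract_val (\<lambda>_. 1) (C (p 3)) (val_one c)"
    unfolding entries[symmetric] abc val_one_def by (rule fract_val_to_fract)+
  \<comment> \<open>All variables of the initial cluster have value 1, against the strict
    maximum.\<close>
  have "C \<noteq> (\<lambda>j. to_fract (var j))"
  proof
    assume "C = (\<lambda>j. to_fract (var j))"
    then have "a = var (p 1)" "b = var (p 2)" using entries abc by simp_all
    then show False using assms(2) by (simp add: val_one_simps)
  qed
  then obtain i where i: "reduced_cluster k C i"
    using labeled_cluster_reduced[OF C] by blast
  from reduced_cluster_max[OF i] obtain r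
    where r: "\<And>j. fract_val (\<lambda>_. 1) (C j) (r j)" "\<And>j. j \<noteq> i \<Longrightarrow> r j < r i" by blast
  have uniq: "r j = s" if "fract_val (\<lambda>_. 1) (C j) s" for j s
    using fract_val_unique[OF _ r(1) that] by simp
  \<comment> \<open>The strict maximum of the values sits in the last mutated position, and by
    assumption in the middle.\<close>
  have "p 2 = i"
  proof (rule ccontr)
    assume "p 2 \<noteq> i"
    then have "i = p 1 \<or> i = p 3" "r (p 2) < r i" using perm3_exhaust[OF p, of i] r(2) by auto
    then show False using assms(2) val[THEN uniq] by auto
  qed
  then obtain f \<sigma> v where v: "\<sigma> permutes UNIV" "cmm_tree k \<sigma> f v = (X, Y, Z)"
    using reduced_cluster_in_tree[OF i p _ t entries] by blast
  show ?thesis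
  proof (rule ex1I[of _ "(f, \<sigma>, v)"])
    show "case (f, \<sigma>, v) of (f, \<sigma>, v) \<Rightarrow> \<sigma> permutes UNIV \<and> cmm_tree k \<sigma> f v = (X, Y, Z)"
      using v by simp
  next
    fix u :: "laurent \<times> (3 \<Rightarrow> 3) \<times> direction list"
    assume "case u of (f, \<sigma>, v) \<Rightarrow> \<sigma> permutes UNIV \<and> cmm_tree k \<sigma> f v = (X, Y, Z)"
    then show "u = (f, \<sigma>, v)"
      using cmm_tree_inj[OF _ v(1) _ v(2) t] by (cases u) auto
  qed
qed

end
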